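(* Let $n\ge 1$ be an integer. Then $$\sum_{p}\Delta(n,p)=\sum_{k=1}^{n}\varphi(k)\,\omega(k),$$ where the sum on the left runs over all primes $p$ (only finitely many terms are nonzero, since $\Delta(n,p)=0$ for $p>n$).
   Context: Here $\varphi$ denotes Euler's totient function, $\omega(k)$ denotes the number of distinct prime divisors of $k$ (so $\omega(1)=0$), and for a prime $p$ and real $x\ge 1$, $\Delta(x,p)=\sum_{\substack{k\le x\\ p\mid k}}\varphi(k)$, the sum being over positive integers $k\le x$ divisible by $p$ (an empty sum is $0$). *)

theory Defs
  imports "HOL-Analysis.Infinite_Sum" "HOL-Number_Theory.Totient"
begin

definition omega :: "nat \<Rightarrow> nat" where
  "omega k = card (prime_factors k)"

definition Delta :: "real \<Rightarrow> nat \<Rightarrow> nat" where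
  "Delta x p = (\<Sum>k | 0 < k \<and> real k \<le> x \<and> p dvd k. totient k)"

end

theory Submission
  imports Defs
begin

text \<open>
  Both sides sum \<^term>\<open>totient k\<close> over the pairs \<open>(p, k)\<close> with \<open>p\<close> a prime dividing \<open>k\<close> and
  \<open>1 \<le> k \<le> n\<close>. Collecting the pairs by \<open>p\<close> gives the left side, while collecting them by \<open>k\<close>
  counts \<^term>\<open>totient k\<close> once for every prime divisor of \<open>k\<close>. A divisor of \<open>k\<close> is at most
  \<open>k \<le> n\<close>, so only the primes up to \<open>n\<close> contribute and the exchange concerns finite sums.
\<close>

lemma Delta_of_nat: "Delta (real n) p = (\<Sum>k | k \<in> {1..n} \<and> p dvd k. totient k)"
  unfolding Delta_def by (rule sum.cong) auto

lemma Delta_eq_0_if_greater: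
  assumes "p > n"
  shows "Delta (real n) p = 0"
proof -
  have no_multiples: "{k. k \<in> {1..n} \<and> p dvd k} = {}"
    using assms by (auto dest: dvd_imp_le)
  show ?thesis
    unfolding Delta_of_nat no_multiples by simp
qed

lemma prime_factors_eq_primes_upto:
  fixes k n :: nat
  assumes "k \<in> {1..n}"
  shows "prime_factors k = {p \<in> {p. prime p \<and> p \<le> n}. p dvd k}"
  using assms by (auto simp: prime_factors_dvd dest: dvd_imp_le)

lemma sum_Delta_primes_upto:
  "(\<Sum>p | prime p \<and> p \<le> n. Delta (real n) p) = (\<Sum>k=1..n. totient k * omega k)"
proof -
  let ?P = "{p. prime p \<and> p \<le> n}"
  have "(\<Sum>p\<in>?P. Delta (real n) p) = (\<Sum>p\<in>?P. \<Sum>k | k \<in> {1..n} \<and> p dvd k. totient k)"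
    by (simp only: Delta_of_nat)
  also have "\<dots> = (\<Sum>k=1..n. \<Sum>p | p \<in> ?P \<and> p dvd k. totient k)"
    by (rule sum.swap_restrict) auto
  also have "\<dots> = (\<Sum>k=1..n. totient k * omega k)"
  proof (rule sum.cong)
    fix k assume "k \<in> {1..n}"
    then show "(\<Sum>p | p \<in> ?P \<and> p dvd k. totient k) = totient k * omega k"
      by (simp only: omega_def prime_factors_eq_primes_upto sum_constant of_nat_id mult.commute)
  qed simp
  finally show ?thesis .
qed

theorem proposition4p1:
  fixes n :: nat
  assumes "n \<ge> 1"
  shows "(\<forall>p. prime p \<and> p > n \<longrightarrow> Delta (real n) p = 0) \<and>
    finite {p. prime p \<and> Delta (real n) p \<noteq> 0} \<and>
    (\<Sum>\<^sub>\<infinity>p\<in>{p. prime p}. Delta (real n) p) = (\<Sum>k=1..n. totient k * omega k)"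
proof (intro conjI)
  show "\<forall>p. prime p \<and> p > n \<longrightarrow> Delta (real n) p = 0"
    by (simp add: Delta_eq_0_if_greater)
  have "{p. prime p \<and> Delta (real n) p \<noteq> 0} \<subseteq> {..n}"
    using Delta_eq_0_if_greater[of n] by (force simp: not_less[symmetric])
  then show "finite {p. prime p \<and> Delta (real n) p \<noteq> 0}"
    by (rule finite_subset) simp
  have "(\<Sum>\<^sub>\<infinity>p\<in>{p. prime p}. Delta (real n) p)
      = (\<Sum>\<^sub>\<infinity>p\<in>{p. prime p \<and> p \<le> n}. Delta (real n) p)"
    by (rule infsum_cong_neutral) (auto simp: Delta_eq_0_if_greater)
  also have "\<dots> = (\<Sum>p | prime p \<and> p \<le> n. Delta (real n) p)"
    by (rule infsum_finite) simp
  also have "\<dots> = (\<Sum>k=1..n. totient k * omega k)"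
    by (rule sum_Delta_primes_upto)
  finally show "(\<Sum>\<^sub>\<infinity>p\<in>{p. prime p}. Delta (real n) p) = (\<Sum>k=1..n. totient k * omega k)" .
qed

end
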